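(* Let $\mathcal{A}$ be a regular Rickart *-ring and $b\in\mathcal{A}$. Then $[0,b]^{\ell*|\ell\square}$, $[0,b]^{\ell*|r\square}$ and $[0,b]^{\ell*|\square}$ are lattices which, in addition, are sublattices of the lattice $[0,b]^{\ell*}$. Furthermore, $[0,b]^{\ell*|\square}$ is a sublattice of both $[0,b]^{\ell*|\ell\square}$ and $[0,b]^{\ell*|r\square}$.
   Context: A *-ring is an (associative) ring $\mathcal{A}$ with an involution $*$: $(a+b)^*=a^*+b^*$, $(ab)^*=b^*a^*$, $(a^* )^*=a$. It is a Rickart *-ring if for every $a\in\mathcal{A}$ there is a self-adjoint idempotent $p$ (i.e. $p=p^*=p^2$) with $\{x\in\mathcal{A}: xa=0\}=\mathcal{A}(1-p)$; such a ring has an identity $1$, and $p$ is unique and denoted $\mathrm{lp}(a)$. Likewise, for every $a$ there is a unique self-adjoint idempotent $\mathrm{rp}(a)$ with $\{x\in\mathcal{A}: ax=0\}=(1-\mathrm{rp}(a))\mathcal{A}$. The ring is regular if for every $a\in\mathcal{A}$ there is $a^-\in\mathcal{A}$ with $aa^-a=a$. Partial orders on $\mathcal{A}$: $a\preceq^{\ell*} b$ iff $\mathrm{lp}(a)b=a=\mathrm{lp}(b)a$ (left star order); $a\preceq^{\ell*|\ell\square} b$ iff $a\preceq^{\ell*}b$ and $a^2=ab$; $a\preceq^{\ell*|r\square} b$ iff $a\preceq^{\ell*}b$ and $a^2=ba$; $a\preceq^{\ell*|\square} b$ iff $a\preceq^{\ell*}b$ and $a^2=ab=ba$. For each such $\alpha$,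 $[0,b]^{\alpha}=\{a\in\mathcal{A}: a\preceq^{\alpha}b\}$, ordered by $\preceq^{\alpha}$. The poset $[0,b]^{\ell*}$ is a lattice (order-isomorphic to the set of self-adjoint idempotents $p$ with $p=p\,\mathrm{lp}(b)$, ordered by $p\le q$ iff $p=pq$). A sublattice of a lattice $L$ is a nonempty subset closed under the operations $\vee$ and $\wedge$ of $L$. *)

theory Defs
  imports Main "HOL-Algebra.Lattice"
begin

class star_ring = ring +
  fixes star :: "'a \<Rightarrow> 'a"
  assumes star_add: "star (a + b) = star a + star b"
    and star_mult: "star (a * b) = star b * star a"
    and star_star: "star (star a) = a"
begin

definition projection :: "'a \<Rightarrow> bool" where
  "projection p \<longleftrightarrow> p = star p \<and> p = p * p"

end

(* The unit comes from monoid_mult rather than from ring_1, so that 0 = 1 (the zero ring) is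
   not excluded. *)
class rickart_star_ring = star_ring + monoid_mult +
  assumes rickart: "\<exists>p. projection p \<and> {x. x * a = 0} = {y * (1 - p) | y. True}"

class regular_ring = ring +
  assumes regular: "\<exists>a'. a * a' * a = a"

definition lp :: "'a::rickart_star_ring \<Rightarrow> 'a" where
  "lp a = (THE p. projection p \<and> {x. x * a = 0} = {y * (1 - p) | y. True})"

lemma left_projection_unique:
  fixes p q :: "'a::rickart_star_ring"
  assumes p: "projection p" and q: "projection q"
    and eq: "{y * (1 - p) | y. True} = {y * (1 - q) | y. True}"
  shows "p = q"
proof -
  have pp: "p * p = p" "star p = p" and qq: "q * q = q" "star q = q"
    using p q unfolding projection_def by (metis, metis, metis, metis)
  have "1 * (1 - p) \<in> {y * (1 - p) | y. True}" "1 * (1 - q) \<in> {y * (1 - q) | y. True}"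
    by blast+
  then have "1 - p \<in> {y * (1 - q) | y. True}" "1 - q \<in> {y * (1 - p) | y. True}"
    by (simp_all only: eq mult_1_left)
  then obtain y z where y: "1 - p = y * (1 - q)" and z: "1 - q = z * (1 - p)" by blast
  have "(1 - p) * q = 0"
    unfolding y by (simp add: algebra_simps qq)
  then have 1: "p * q = q" by (simp add: algebra_simps)
  have "(1 - q) * p = 0"
    unfolding z by (simp add: algebra_simps pp)
  then have "q * p = p" by (simp add: algebra_simps)
  then have "star (q * p) = star p" by simp
  then have "p * q = p" by (simp add: star_mult pp qq)
  with 1 show ?thesis by simp
qed

lemma lp_properties:
  fixes a :: "'a::rickart_star_ring"
  shows "projection (lp a)" and "{x. x * a = 0} = {y * (1 - lp a) | y. True}"
proof -
  let ?P = "\<lambda>p. projection p \<and> {x. x * a = 0} = {y * (1 - p) | y. True}"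
  obtain p where p: "?P p" using rickart by blast
  have "?P (THE p. ?P p)"
  proof (rule theI)
    show "?P p" by (rule p)
    show "q = p" if "?P q" for q
    proof (rule left_projection_unique)
      show "projection q" "projection p" using conjunct1[OF that] conjunct1[OF p] .
      show "{y * (1 - q) | y. True} = {y * (1 - p) | y. True}"
        using conjunct2[OF that] conjunct2[OF p] by (rule trans[OF sym])
    qed
  qed
  then show "projection (lp a)" "{x. x * a = 0} = {y * (1 - lp a) | y. True}"
    unfolding lp_def by (rule conjunct1, rule conjunct2)
qed

definition left_star_le :: "'a::rickart_star_ring \<Rightarrow> 'a \<Rightarrow> bool" where
  "left_star_le a b \<longleftrightarrow> lp a * b = a \<and> a = lp b * a"

definition left_star_left_sharp_le :: "'a::rickart_star_ring \<Rightarrow> 'a \<Rightarrow> bool" where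
  "left_star_left_sharp_le a b \<longleftrightarrow> left_star_le a b \<and> a * a = a * b"

definition left_star_right_sharp_le :: "'a::rickart_star_ring \<Rightarrow> 'a \<Rightarrow> bool" where
  "left_star_right_sharp_le a b \<longleftrightarrow> left_star_le a b \<and> a * a = b * a"

definition left_star_sharp_le :: "'a::rickart_star_ring \<Rightarrow> 'a \<Rightarrow> bool" where
  "left_star_sharp_le a b \<longleftrightarrow> left_star_le a b \<and> a * a = a * b \<and> a * b = b * a"

(* On [0,b] each of the three finer orders is the restriction of the left star order, so for
   these segments the induced order of a sublattice is the order they already carry. *)
lemma left_star_left_sharp_le_on_segment:
  assumes a: "left_star_left_sharp_le a b" and c: "left_star_left_sharp_le c b"
  shows "left_star_left_sharp_le a c \<longleftrightarrow> left_star_le a c"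
proof -
  have "a * a = a * c" if l: "left_star_le a c"
  proof -
    have h: "lp a * b = a" "lp c * b = c" "a * a = a * b" "c * c = c * b" "lp a * c = a"
      using a c l unfolding left_star_left_sharp_le_def left_star_le_def by auto
    have "a * c = lp a * (c * c)" using h by (metis mult.assoc)
    also have "\<dots> = a * b" using h by (metis mult.assoc)
    finally show ?thesis using h by simp
  qed
  then show ?thesis unfolding left_star_left_sharp_le_def by auto
qed

lemma left_star_right_sharp_le_on_segment:
  assumes a: "left_star_right_sharp_le a b" and c: "left_star_right_sharp_le c b"
  shows "left_star_right_sharp_le a c \<longleftrightarrow> left_star_le a c"
proof -
  have "a * a = c * a" if l: "left_star_le a c"
  proof -
    have h: "lp c * b = c" "a * a = b * a" "lp c * a = a"
      using a c l unfolding left_star_right_sharp_le_def left_star_le_def by auto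
    have "c * a = lp c * (b * a)" using h by (metis mult.assoc)
    also have "\<dots> = a * a" using h by (metis mult.assoc)
    finally show ?thesis by simp
  qed
  then show ?thesis unfolding left_star_right_sharp_le_def by auto
qed

lemma left_star_sharp_le_iff:
  "left_star_sharp_le a b \<longleftrightarrow> left_star_left_sharp_le a b \<and> left_star_right_sharp_le a b"
  unfolding left_star_sharp_le_def left_star_left_sharp_le_def left_star_right_sharp_le_def
  by auto

lemma left_star_sharp_le_on_segment:
  assumes "left_star_sharp_le a b" and "left_star_sharp_le c b"
  shows "left_star_sharp_le a c \<longleftrightarrow> left_star_le a c"
  using assms left_star_left_sharp_le_on_segment[of a b c]
    left_star_right_sharp_le_on_segment[of a b c]
  unfolding left_star_sharp_le_iff by blast

(* The initial segment [0,b] of the order r, itself ordered by r. *)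
definition segment :: "('a \<Rightarrow> 'a \<Rightarrow> bool) \<Rightarrow> 'a \<Rightarrow> 'a gorder" where
  "segment r b = \<lparr>carrier = {a. r a b}, eq = (=), le = r\<rparr>"

definition sublattice :: "'a set \<Rightarrow> 'a gorder \<Rightarrow> bool" where
  "sublattice S L \<longleftrightarrow> Lattice.lattice L \<and> S \<noteq> {} \<and> S \<subseteq> carrier L \<and>
     (\<forall>x\<in>S. \<forall>y\<in>S. x \<squnion>\<^bsub>L\<^esub> y \<in> S \<and> x \<sqinter>\<^bsub>L\<^esub> y \<in> S)"

end

theory Submission
  imports Defs
begin

text \<open>
  The map p \<mapsto> p b is an order isomorphism from the projections below lp b onto the left star
  segment [0,b]. Under it the right sharp condition becomes b p = p b p, invariance of p under b,
  and the left sharp condition becomes invariance of p under (b lp(b))*. The projections of a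
  Rickart *-ring that are invariant under a fixed element are closed under meet and join.
\<close>

section \<open>Projections of a Rickart *-ring\<close>

lemma projection_simps:
  assumes "projection p"
  shows "p * p = p" and "star p = p"
  using assms unfolding projection_def by metis+

lemma star_zero [simp]: "star (0::'a::star_ring) = 0"
  using star_add[of "0::'a" 0] by simp

lemma star_one [simp]: "star (1::'a::rickart_star_ring) = 1"
  \<comment> \<open>Evaluate \<open>star (1 * star 1)\<close> in two ways: directly it is
    \<open>1\<close>, by \<open>star_mult\<close> it is \<open>star 1\<close>.\<close>
  using star_mult[of 1 "star (1::'a)"] by (simp add: star_star)

lemma star_diff: "star (a - b) = star a - star (b::'a::star_ring)"
  using star_add[of "a - b" b] by simp

lemma star_eq_iff: "star a = star b \<longleftrightarrow> a = (b::'a::star_ring)"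
  by (metis star_star)

lemma projection_zero [simp]: "projection (0::'a::star_ring)"
  by (simp add: projection_def)

lemma projection_compl:
  fixes p :: "'a::rickart_star_ring"
  assumes "projection p"
  shows "projection (1 - p)"
  unfolding projection_def by (simp add: star_diff algebra_simps projection_simps[OF assms])

text \<open>The involution exchanges the two products. Either equation expresses p \<le> q among
  projections.\<close>

lemma projection_mult_eq_iff:
  assumes "projection p" "projection q"
  shows "p * q = p \<longleftrightarrow> q * p = p"
  using star_eq_iff[of "p * q" p] assms by (simp add: star_mult projection_simps)

text \<open>Both sides say that \<open>x\<close> lies in the left ideal generated by
  \<open>1 - lp a\<close>. This is the working form of the defining property of
  \<open>lp\<close>.\<close>

lemma mult_eq_zero_iff_lp:
  fixes a x :: "'a::rickart_star_ring"
  shows "x * a = 0 \<longleftrightarrow> x * lp a = 0"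
proof
  have idem: "lp a * lp a = lp a" using lp_properties(1) by (rule projection_simps)
  assume "x * a = 0"
  then obtain y where "x = y * (1 - lp a)" using lp_properties(2)[of a] by blast
  then show "x * lp a = 0" by (simp add: mult.assoc left_diff_distrib idem)
next
  assume "x * lp a = 0"
  then have "x = x * (1 - lp a)" by (simp add: algebra_simps)
  then show "x * a = 0" using lp_properties(2)[of a] by blast
qed

lemma lp_mult_self [simp]: "lp a * a = a"
proof -
  have "(1 - lp a) * a = 0"
    using mult_eq_zero_iff_lp[of "1 - lp a" a] projection_simps[OF lp_properties(1)[of a]]
    by (simp add: algebra_simps)
  then show ?thesis by (simp add: algebra_simps)
qed

text \<open>Annihilation by \<open>1 - p\<close>. It replaces an arbitrary \<open>y\<close> by a
  projection, for which left and right products can be exchanged.\<close>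

lemma mult_left_fix_iff_lp:
  fixes p y :: "'a::rickart_star_ring"
  shows "p * y = y \<longleftrightarrow> p * lp y = lp y"
  using mult_eq_zero_iff_lp[of "1 - p" y] by (auto simp: algebra_simps)

text \<open>Testing the annihilators on \<open>1 - p\<close> and \<open>1 - lp a\<close> shows that
  each projection is below the other.\<close>

lemma lp_eqI:
  fixes a p :: "'a::rickart_star_ring"
  assumes p: "projection p" and ann: "\<And>x. x * a = 0 \<longleftrightarrow> x * p = 0"
  shows "lp a = p"
proof -
  have "(1 - p) * lp a = 0"
    using ann[of "1 - p"] mult_eq_zero_iff_lp[of "1 - p" a] projection_simps[OF p]
    by (simp add: algebra_simps)
  moreover have "(1 - lp a) * p = 0"
    using ann[of "1 - lp a"] by (simp add: algebra_simps)
  ultimately have "p * lp a = lp a" "lp a * p = p" by (simp_all add: algebra_simps)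
  then show ?thesis using projection_mult_eq_iff[OF p lp_properties(1)[of a]] by simp
qed

text \<open>The classical closed formula for the infimum of two projections in a Rickart *-ring; the
  supremum follows by De Morgan.\<close>

definition proj_meet :: "'a::rickart_star_ring \<Rightarrow> 'a \<Rightarrow> 'a" where
  "proj_meet p q = p - lp (p * (1 - q))"

definition proj_join :: "'a::rickart_star_ring \<Rightarrow> 'a \<Rightarrow> 'a" where
  "proj_join p q = 1 - proj_meet (1 - p) (1 - q)"

text \<open>With \<open>e = lp (p * (1 - q))\<close>, the projection \<open>e\<close> is below
  \<open>p\<close>, so \<open>p - e\<close> is a projection; it annihilates
  \<open>p * (1 - q)\<close> and is therefore below \<open>q\<close>. Allowing any ring element
  \<open>y\<close>, not only projections, is what later transfers invariance to meets.\<close>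

lemma
  fixes p q :: "'a::rickart_star_ring"
  assumes p: "projection p" and q: "projection q"
  shows projection_proj_meet: "projection (proj_meet p q)"
    and proj_meet_fix_iff: "proj_meet p q * y = y \<longleftrightarrow> p * y = y \<and> q * y = y"
proof -
  define e where "e = lp (p * (1 - q))"
  let ?m = "proj_meet p q"
  have m_def: "?m = p - e" by (simp add: proj_meet_def e_def)
  have e: "projection e" unfolding e_def by (rule lp_properties(1))
  note pp = projection_simps[OF p] and qq = projection_simps[OF q]
  note ee = projection_simps[OF e]
  have "p * (p * (1 - q)) = p * (1 - q)" using pp by (metis mult.assoc)
  then have pe: "p * e = e" unfolding e_def using mult_left_fix_iff_lp by blast
  then have ep: "e * p = e" using projection_mult_eq_iff[OF e p] by blast
  show m: "projection ?m"
    unfolding projection_def m_def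
    by (simp add: star_diff algebra_simps pp ee pe ep)
  note mm = projection_simps[OF m]
  have pm: "p * ?m = ?m" unfolding m_def by (simp add: algebra_simps pp pe)
  have mp: "?m * p = ?m" unfolding m_def by (simp add: algebra_simps pp ep)
  have "?m * (1 - q) = ?m * (p * (1 - q))" using mp by (metis mult.assoc)
  also have "\<dots> = p * p * (1 - q) - e * (p * (1 - q))"
    unfolding m_def by (simp only: left_diff_distrib mult.assoc)
  also have "\<dots> = 0" by (simp only: e_def lp_mult_self pp) simp
  finally have "?m * q = ?m" by (simp add: algebra_simps)
  then have qm: "q * ?m = ?m" using projection_mult_eq_iff[OF m q] by blast
  show "?m * y = y \<longleftrightarrow> p * y = y \<and> q * y = y"
  proof
    assume "?m * y = y"
    then show "p * y = y \<and> q * y = y" using pm qm by (metis mult.assoc)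
  next
    let ?t = "lp y"
    assume "p * y = y \<and> q * y = y"
    \<comment> \<open>The projection \<open>lp y\<close> is below \<open>p\<close> and
      \<open>q\<close>, so it annihilates \<open>p * (1 - q)\<close> from the left, and hence also
      \<open>e\<close>.\<close>
    then have "p * ?t = ?t" "q * ?t = ?t" using mult_left_fix_iff_lp by blast+
    then have tp: "?t * p = ?t" and tq: "?t * q = ?t"
      using projection_mult_eq_iff[OF lp_properties(1)] p q by blast+
    have "?t * (p * (1 - q)) = 0"
      by (simp only: mult.assoc[symmetric] tp) (simp add: algebra_simps tq)
    then have "?t * e = 0" unfolding e_def using mult_eq_zero_iff_lp by blast
    then have "?t * ?m = ?t" unfolding m_def by (simp add: algebra_simps tp)
    then have "?m * ?t = ?t" using projection_mult_eq_iff[OF lp_properties(1) m] by blast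
    then show "?m * y = y" using mult_left_fix_iff_lp by blast
  qed
qed

lemma projection_proj_join:
  "projection p \<Longrightarrow> projection q \<Longrightarrow> projection (proj_join p q)"
  unfolding proj_join_def by (intro projection_compl projection_proj_meet)

text \<open>The involution turns \<open>x * r = 0\<close> into the statement that
  \<open>1 - r\<close> fixes \<open>star x\<close>, so this is the meet property of the complements
  \<open>1 - p\<close> and \<open>1 - q\<close>.\<close>

lemma mult_proj_join_eq_zero_iff:
  fixes p q x :: "'a::rickart_star_ring"
  assumes p: "projection p" and q: "projection q"
  shows "x * proj_join p q = 0 \<longleftrightarrow> x * p = 0 \<and> x * q = 0"
proof -
  have star: "x * r = 0 \<longleftrightarrow> (1 - r) * star x = star x" if "projection r" for r
    using star_eq_iff[of "x * r" 0] projection_simps[OF that]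
    by (simp add: star_mult algebra_simps)
  show ?thesis
    using proj_meet_fix_iff[OF projection_compl[OF p] projection_compl[OF q], of "star x"]
    by (simp add: star p q projection_proj_join) (simp add: proj_join_def)
qed

text \<open>The case \<open>x = 1 - r\<close> of the annihilation property; it makes
  \<open>proj_join\<close> the least upper bound.\<close>

lemma mult_proj_join_fix_iff:
  fixes p q r :: "'a::rickart_star_ring"
  assumes "projection p" "projection q" "projection r"
  shows "r * proj_join p q = proj_join p q \<longleftrightarrow> r * p = p \<and> r * q = q"
  using mult_proj_join_eq_zero_iff[OF assms(1,2), of "1 - r"] by (auto simp: algebra_simps)

section \<open>Invariant projections\<close>

text \<open>For operators, the equation says that the range of \<open>p\<close> is an invariant
  subspace of \<open>c\<close>.\<close>

definition invariant_projections :: "'a::rickart_star_ring \<Rightarrow> 'a set" where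
  "invariant_projections c = {p. projection p \<and> p * (c * p) = c * p}"

text \<open>Containing \<open>0\<close> keeps such a set nonempty, also after intersecting two of
  them.\<close>

definition proj_sublattice :: "'a::rickart_star_ring set \<Rightarrow> bool" where
  "proj_sublattice S \<longleftrightarrow> 0 \<in> S \<and> (\<forall>p\<in>S. projection p) \<and>
     (\<forall>p\<in>S. \<forall>q\<in>S. proj_meet p q \<in> S \<and> proj_join p q \<in> S)"

lemma proj_sublattice_Int:
  "proj_sublattice S \<Longrightarrow> proj_sublattice T \<Longrightarrow> proj_sublattice (S \<inter> T)"
  unfolding proj_sublattice_def by blast

lemma proj_sublattice_invariant: "proj_sublattice (invariant_projections c)"
  unfolding proj_sublattice_def
proof (intro conjI ballI)
  show "0 \<in> invariant_projections c" by (simp add: invariant_projections_def)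
next
  fix p assume "p \<in> invariant_projections c"
  then show "projection p" by (simp add: invariant_projections_def)
next
  fix p q assume "p \<in> invariant_projections c" "q \<in> invariant_projections c"
  then have p: "projection p" "p * (c * p) = c * p" and q: "projection q" "q * (c * q) = c * q"
    by (simp_all add: invariant_projections_def)
  let ?m = "proj_meet p q" and ?j = "proj_join p q"
  have m: "projection ?m" and j: "projection ?j"
    using p q by (simp_all add: projection_proj_meet projection_proj_join)
  have "p * ?m = ?m" "q * ?m = ?m"
    using proj_meet_fix_iff[OF p(1) q(1), of ?m] projection_simps(1)[OF m] by blast+
  \<comment> \<open>Write \<open>?m\<close> as \<open>p * ?m\<close> and use that \<open>p\<close>
    fixes \<open>c * p\<close>; likewise for \<open>q\<close>.\<close>
  then have "p * (c * ?m) = c * ?m" "q * (c * ?m) = c * ?m" using p q by (metis mult.assoc)+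
  then show "?m \<in> invariant_projections c"
    using m proj_meet_fix_iff[OF p(1) q(1)] by (simp add: invariant_projections_def)
  have "?j * p = p" "?j * q = q"
    using mult_proj_join_fix_iff[OF p(1) q(1) j] projection_simps(1)[OF j] by blast+
  then have "?j * (c * p) = c * p" "?j * (c * q) = c * q" using p q by (metis mult.assoc)+
  \<comment> \<open>The join is controlled through what annihilates it from the left, so invariance
    is recast as \<open>c - ?j * c\<close> annihilating \<open>?j\<close>.\<close>
  then have "(c - ?j * c) * p = 0" "(c - ?j * c) * q = 0" by (simp_all add: algebra_simps)
  then have "(c - ?j * c) * ?j = 0" using mult_proj_join_eq_zero_iff[OF p(1) q(1)] by blast
  then show "?j \<in> invariant_projections c"
    using j by (simp add: invariant_projections_def algebra_simps)
qed

lemma proj_sublattice_below: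
  assumes "projection r"
  shows "proj_sublattice {p. projection p \<and> r * p = p}"
  unfolding proj_sublattice_def
proof (intro conjI ballI)
  fix p q assume "p \<in> {p. projection p \<and> r * p = p}" "q \<in> {p. projection p \<and> r * p = p}"
  then have p: "projection p" "r * p = p" and q: "projection q" "r * q = q" by simp_all
  show "proj_join p q \<in> {p. projection p \<and> r * p = p}"
    using mult_proj_join_fix_iff[OF p(1) q(1) assms] p q by (simp add: projection_proj_join)
  have m: "projection (proj_meet p q)" using p q by (simp add: projection_proj_meet)
  then have "p * proj_meet p q = proj_meet p q"
    using proj_meet_fix_iff[OF p(1) q(1), of "proj_meet p q"] projection_simps(1) by blast
  then have "r * proj_meet p q = proj_meet p q" using p by (metis mult.assoc)
  then show "proj_meet p q \<in> {p. projection p \<and> r * p = p}" using m by simp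
qed auto

section \<open>The segments as lattices of projections\<close>

abbreviation below_lp :: "'a::rickart_star_ring \<Rightarrow> 'a set" where
  "below_lp b \<equiv> {p. projection p \<and> lp b * p = p}"

lemma below_lp_right: "p \<in> below_lp b \<Longrightarrow> p * lp b = p"
  using projection_mult_eq_iff[of p "lp b"] lp_properties(1)[of b] by blast

text \<open>By \<open>mult_eq_zero_iff_lp\<close> the factor \<open>b\<close> may be replaced by
  \<open>lp b\<close>, which \<open>p\<close> absorbs. Thus \<open>lp\<close> inverts the map from
  \<open>p\<close> to \<open>p * b\<close>.\<close>

lemma lp_mult_below:
  assumes "p \<in> below_lp b"
  shows "lp (p * b) = p"
proof (rule lp_eqI)
  show "projection p" using assms by simp
  show "x * (p * b) = 0 \<longleftrightarrow> x * p = 0" for x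
    using mult_eq_zero_iff_lp[of "x * p" b] below_lp_right[OF assms]
    by (simp add: mult.assoc)
qed

lemma left_star_le_iff: "left_star_le a b \<longleftrightarrow> a \<in> (\<lambda>p. p * b) ` below_lp b"
proof
  assume "left_star_le a b"
  then have "a = lp a * b" "lp b * a = a" unfolding left_star_le_def by auto
  then show "a \<in> (\<lambda>p. p * b) ` below_lp b"
    using lp_properties(1)[of a] mult_left_fix_iff_lp[of "lp b" a] by blast
next
  assume "a \<in> (\<lambda>p. p * b) ` below_lp b"
  then obtain p where p: "p \<in> below_lp b" "a = p * b" by blast
  then have "lp b * (p * b) = p * b" by (simp add: mult.assoc[symmetric])
  then show "left_star_le a b" unfolding left_star_le_def using p lp_mult_below[OF p(1)] by simp
qed

text \<open>Since \<open>lp\<close> recovers \<open>p\<close> and \<open>q\<close>, the left star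
  order on the segment is the order of the projections.\<close>

lemma left_star_le_mult_iff:
  assumes p: "p \<in> below_lp b" and q: "q \<in> below_lp b"
  shows "left_star_le (p * b) (q * b) \<longleftrightarrow> q * p = p"
proof
  assume "left_star_le (p * b) (q * b)"
  then have "q * (p * b) = p * b"
    unfolding left_star_le_def using lp_mult_below[OF p] lp_mult_below[OF q] by simp
  then show "q * p = p"
    using mult_left_fix_iff_lp[of q "p * b"] lp_mult_below[OF p] by simp
next
  assume qp: "q * p = p"
  then have pq: "p * q = p" using projection_mult_eq_iff[of p q] p q by blast
  show "left_star_le (p * b) (q * b)"
    unfolding left_star_le_def lp_mult_below[OF p] lp_mult_below[OF q]
    by (simp add: mult.assoc[symmetric] pq qp)
qed

text \<open>Replacing the last factor \<open>b\<close> by \<open>lp b\<close> gives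
  \<open>p * b * p = p * b * lp b\<close>. Here \<open>p\<close> stands on the left of
  \<open>b\<close>, so the involution is applied to obtain an invariance condition.\<close>

lemma left_sharp_iff_invariant:
  assumes p: "p \<in> below_lp b"
  shows "(p * b) * (p * b) = (p * b) * b \<longleftrightarrow> p \<in> invariant_projections (star (b * lp b))"
proof -
  have pr: "projection p" using p by simp
  note pp = projection_simps[OF pr] and bb = projection_simps[OF lp_properties(1), of b]
  have "(p * b) * (p * b) = (p * b) * b \<longleftrightarrow> (p * b * p - p * b) * b = 0"
    by (simp add: algebra_simps)
  also have "\<dots> \<longleftrightarrow> (p * b * p - p * b) * lp b = 0" by (rule mult_eq_zero_iff_lp)
  also have "\<dots> \<longleftrightarrow> p * b * p = p * b * lp b"
    using below_lp_right[OF p] by (simp add: left_diff_distrib mult.assoc)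
  also have "\<dots> \<longleftrightarrow> p * (star b * p) = lp b * (star b * p)"
    using star_eq_iff[of "p * b * p" "p * b * lp b"] by (simp add: star_mult pp bb mult.assoc)
  \<comment> \<open>Since \<open>p * lp b = p\<close>, a factor \<open>lp b\<close> can be inserted,
    so that both sides contain the same element \<open>star (b * lp b)\<close>.\<close>
  also have "p * (star b * p) = p * (star (b * lp b) * p)"
    using below_lp_right[OF p] by (simp add: star_mult bb) (metis mult.assoc)
  also have "lp b * (star b * p) = star (b * lp b) * p" by (simp add: star_mult bb mult.assoc)
  finally show ?thesis using pr by (simp add: invariant_projections_def)
qed

text \<open>The same replacement of \<open>b\<close> by \<open>lp b\<close>; now \<open>p\<close>
  absorbs \<open>lp b\<close> in both terms, and invariance appears without the involution.\<close>

lemma right_sharp_iff_invariant: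
  assumes p: "p \<in> below_lp b"
  shows "(p * b) * (p * b) = b * (p * b) \<longleftrightarrow> p \<in> invariant_projections b"
proof -
  have "(p * b) * (p * b) = b * (p * b) \<longleftrightarrow> (p * b * p - b * p) * b = 0"
    by (simp add: algebra_simps)
  also have "\<dots> \<longleftrightarrow> (p * b * p - b * p) * lp b = 0" by (rule mult_eq_zero_iff_lp)
  also have "\<dots> \<longleftrightarrow> p * (b * p) = b * p"
    using below_lp_right[OF p] by (simp add: left_diff_distrib mult.assoc)
  finally show ?thesis using p by (simp add: invariant_projections_def)
qed

text \<open>Common frame for the four orders: \<open>S\<close> is the set of projections that
  parametrises the segment. Joins and meets come from the same ring formulas for every
  \<open>S\<close>, so they agree between segments.\<close>

locale projection_segment =
  fixes r :: "'a::rickart_star_ring \<Rightarrow> 'a \<Rightarrow> bool" and b :: 'a and S :: "'a set"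
  assumes S_sublattice: "proj_sublattice S"
    and S_below: "S \<subseteq> below_lp b"
    and segment_image: "{a. r a b} = (\<lambda>p. p * b) ` S"
    and on_segment: "\<And>a c. r a b \<Longrightarrow> r c b \<Longrightarrow> r a c \<longleftrightarrow> left_star_le a c"
begin

lemma carrier_eq: "carrier (segment r b) = (\<lambda>p. p * b) ` S"
  using segment_image by (simp add: segment_def)

lemma projection_mem: "p \<in> S \<Longrightarrow> projection p"
  using S_sublattice unfolding proj_sublattice_def by blast

lemma meet_mem: "p \<in> S \<Longrightarrow> q \<in> S \<Longrightarrow> proj_meet p q \<in> S"
  and join_mem: "p \<in> S \<Longrightarrow> q \<in> S \<Longrightarrow> proj_join p q \<in> S"
  using S_sublattice unfolding proj_sublattice_def by blast+

lemma le_iff: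
  assumes "p \<in> S" "q \<in> S"
  shows "p * b \<sqsubseteq>\<^bsub>segment r b\<^esub> q * b \<longleftrightarrow> q * p = p"
proof -
  have "r (p * b) b" "r (q * b) b" using assms segment_image by blast+
  then have "r (p * b) (q * b) \<longleftrightarrow> left_star_le (p * b) (q * b)" by (rule on_segment)
  also have "\<dots> \<longleftrightarrow> q * p = p" using assms S_below by (intro left_star_le_mult_iff) blast+
  finally show ?thesis by (simp add: segment_def)
qed

sublocale partial_order "segment r b"
proof (unfold_locales, unfold carrier_eq)
  fix x assume "x \<in> (\<lambda>p. p * b) ` S"
  then obtain p where "p \<in> S" "x = p * b" by blast
  then show "x \<sqsubseteq>\<^bsub>segment r b\<^esub> x"
    using projection_simps(1)[OF projection_mem] by (simp add: le_iff)
next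
  fix x y
  assume le: "x \<sqsubseteq>\<^bsub>segment r b\<^esub> y" "y \<sqsubseteq>\<^bsub>segment r b\<^esub> x"
    and "x \<in> (\<lambda>p. p * b) ` S" "y \<in> (\<lambda>p. p * b) ` S"
  then obtain p q where p: "p \<in> S" "x = p * b" and q: "q \<in> S" "y = q * b" by blast
  then have "q * p = p" "p * q = q" using le by (simp_all add: le_iff)
  then have "p = q" using projection_mult_eq_iff projection_mem p q by metis
  then show "x .=\<^bsub>segment r b\<^esub> y" using p q by (simp add: segment_def)
next
  fix x y z
  assume le: "x \<sqsubseteq>\<^bsub>segment r b\<^esub> y" "y \<sqsubseteq>\<^bsub>segment r b\<^esub> z"
    and "x \<in> (\<lambda>p. p * b) ` S" "y \<in> (\<lambda>p. p * b) ` S" "z \<in> (\<lambda>p. p * b) ` S"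
  then obtain p q s where pqs: "p \<in> S" "x = p * b" "q \<in> S" "y = q * b" "s \<in> S" "z = s * b"
    by blast
  then have "q * p = p" "s * q = q" using le by (simp_all add: le_iff)
  then have "s * p = p" by (metis mult.assoc)
  then show "x \<sqsubseteq>\<^bsub>segment r b\<^esub> z" using pqs by (simp add: le_iff)
qed (simp_all add: segment_def)

lemma least_join:
  assumes p: "p \<in> S" and q: "q \<in> S"
  shows "least (segment r b) (proj_join p q * b) (Upper (segment r b) {p * b, q * b})"
proof (rule least_UpperI)
  note pr = projection_mem[OF p] projection_mem[OF q]
  have j: "proj_join p q \<in> S" by (rule join_mem[OF p q])
  note jj = projection_simps(1)[OF projection_mem[OF j]]
  have jp: "proj_join p q * p = p \<and> proj_join p q * q = q"
    using mult_proj_join_fix_iff[OF pr projection_mem[OF j]] jj by blast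
  show "x \<sqsubseteq>\<^bsub>segment r b\<^esub> proj_join p q * b" if "x \<in> {p * b, q * b}" for x
    using that jp p q j by (auto simp: le_iff)
  show "proj_join p q * b \<sqsubseteq>\<^bsub>segment r b\<^esub> y" if "y \<in> Upper (segment r b) {p * b, q * b}" for y
  proof -
    from that p q have y: "y \<in> (\<lambda>p. p * b) ` S" "p * b \<sqsubseteq>\<^bsub>segment r b\<^esub> y" "q * b \<sqsubseteq>\<^bsub>segment r b\<^esub> y"
      unfolding Upper_def carrier_eq by auto
    then obtain s where s: "s \<in> S" "y = s * b" by blast
    then have "s * p = p \<and> s * q = q" using y p q by (simp add: le_iff)
    then have "s * proj_join p q = proj_join p q"
      using mult_proj_join_fix_iff[OF pr projection_mem[OF s(1)]] by blast
    then show ?thesis using s j by (simp add: le_iff)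
  qed
qed (use p q join_mem in \<open>auto simp: carrier_eq\<close>)

lemma greatest_meet:
  assumes p: "p \<in> S" and q: "q \<in> S"
  shows "greatest (segment r b) (proj_meet p q * b) (Lower (segment r b) {p * b, q * b})"
proof (rule greatest_LowerI)
  note pr = projection_mem[OF p] projection_mem[OF q]
  have m: "proj_meet p q \<in> S" by (rule meet_mem[OF p q])
  have pm: "p * proj_meet p q = proj_meet p q \<and> q * proj_meet p q = proj_meet p q"
    using proj_meet_fix_iff[OF pr] projection_simps(1)[OF projection_mem[OF m]] by blast
  show "proj_meet p q * b \<sqsubseteq>\<^bsub>segment r b\<^esub> x" if "x \<in> {p * b, q * b}" for x
    using that pm p q m by (auto simp: le_iff)
  show "y \<sqsubseteq>\<^bsub>segment r b\<^esub> proj_meet p q * b" if "y \<in> Lower (segment r b) {p * b, q * b}" for y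
  proof -
    from that p q have y: "y \<in> (\<lambda>p. p * b) ` S" "y \<sqsubseteq>\<^bsub>segment r b\<^esub> p * b" "y \<sqsubseteq>\<^bsub>segment r b\<^esub> q * b"
      unfolding Lower_def carrier_eq by auto
    then obtain s where s: "s \<in> S" "y = s * b" by blast
    then have "p * s = s \<and> q * s = s" using y p q by (simp add: le_iff)
    then have "proj_meet p q * s = s" using proj_meet_fix_iff[OF pr] by blast
    then show ?thesis using s m by (simp add: le_iff)
  qed
qed (use p q meet_mem in \<open>auto simp: carrier_eq\<close>)

sublocale Lattice.lattice "segment r b"
proof
  fix x y assume "x \<in> carrier (segment r b)" "y \<in> carrier (segment r b)"
  then obtain p q where "p \<in> S" "x = p * b" "q \<in> S" "y = q * b"
    unfolding carrier_eq by blast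
  then show "\<exists>s. least (segment r b) s (Upper (segment r b) {x, y})"
    and "\<exists>s. greatest (segment r b) s (Lower (segment r b) {x, y})"
    using least_join greatest_meet by blast+
qed

text \<open>The library join is a choice of some least upper bound; uniqueness in a partial order
  identifies it with the explicit one.\<close>

lemma join_eq:
  assumes "p \<in> S" "q \<in> S"
  shows "p * b \<squnion>\<^bsub>segment r b\<^esub> q * b = proj_join p q * b"
  unfolding join_def sup_def
  using least_join[OF assms] by (rule some_equality) (rule least_unique[OF _ least_join[OF assms]])

lemma meet_eq:
  assumes "p \<in> S" "q \<in> S"
  shows "p * b \<sqinter>\<^bsub>segment r b\<^esub> (q * b) = proj_meet p q * b"
  unfolding meet_def inf_def
  using greatest_meet[OF assms]
  by (rule some_equality) (rule greatest_unique[OF _ greatest_meet[OF assms]])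

text \<open>The operations of the segment are given by \<open>proj_join\<close> and
  \<open>proj_meet\<close>, under which \<open>T\<close> is closed.\<close>

lemma sublattice_image:
  assumes T: "proj_sublattice T" "T \<subseteq> S"
  shows "sublattice ((\<lambda>p. p * b) ` T) (segment r b)"
  unfolding sublattice_def
proof (intro conjI ballI)
  show "Lattice.lattice (segment r b)" by (rule lattice_axioms)
  show "(\<lambda>p. p * b) ` T \<noteq> {}" using T unfolding proj_sublattice_def by blast
  show "(\<lambda>p. p * b) ` T \<subseteq> carrier (segment r b)" using T by (auto simp: carrier_eq)
next
  fix x y assume "x \<in> (\<lambda>p. p * b) ` T" "y \<in> (\<lambda>p. p * b) ` T"
  then obtain p q where pq: "p \<in> T" "x = p * b" "q \<in> T" "y = q * b" by blast
  then have "proj_join p q \<in> T" "proj_meet p q \<in> T"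
    using T unfolding proj_sublattice_def by blast+
  moreover have "p \<in> S" "q \<in> S" using pq T by blast+
  ultimately show "x \<squnion>\<^bsub>segment r b\<^esub> y \<in> (\<lambda>p. p * b) ` T" "x \<sqinter>\<^bsub>segment r b\<^esub> y \<in> (\<lambda>p. p * b) ` T"
    by (simp_all add: pq join_eq meet_eq)
qed

end

theorem theorem39:
  fixes b :: "'a::{rickart_star_ring, regular_ring}"
  shows "Lattice.lattice (segment left_star_left_sharp_le b) \<and>
    Lattice.lattice (segment left_star_right_sharp_le b) \<and>
    Lattice.lattice (segment left_star_sharp_le b) \<and>
    sublattice (carrier (segment left_star_left_sharp_le b)) (segment left_star_le b) \<and>
    sublattice (carrier (segment left_star_right_sharp_le b)) (segment left_star_le b) \<and>
    sublattice (carrier (segment left_star_sharp_le b)) (segment left_star_le b) \<and>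
    sublattice (carrier (segment left_star_sharp_le b)) (segment left_star_left_sharp_le b) \<and>
    sublattice (carrier (segment left_star_sharp_le b)) (segment left_star_right_sharp_le b)"
proof -
  let ?S = "below_lp b"
  let ?L = "?S \<inter> invariant_projections (star (b * lp b))"
  let ?R = "?S \<inter> invariant_projections b"
  have S: "proj_sublattice ?S" by (rule proj_sublattice_below[OF lp_properties(1)])
  have L: "proj_sublattice ?L" and R: "proj_sublattice ?R"
    by (intro proj_sublattice_Int S proj_sublattice_invariant)+
  have LR: "proj_sublattice (?L \<inter> ?R)" by (rule proj_sublattice_Int[OF L R])
  have imL: "{a. left_star_left_sharp_le a b} = (\<lambda>p. p * b) ` ?L"
    using left_sharp_iff_invariant[of _ b]
    by (auto simp: left_star_left_sharp_le_def left_star_le_iff)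
  have imR: "{a. left_star_right_sharp_le a b} = (\<lambda>p. p * b) ` ?R"
    using right_sharp_iff_invariant[of _ b]
    by (auto simp: left_star_right_sharp_le_def left_star_le_iff)
  \<comment> \<open>Injectivity lets the image commute with the intersection: an element satisfying
    both sharp conditions comes from one projection in both sets.\<close>
  have "inj_on (\<lambda>p. p * b) ?S" by (rule inj_on_inverseI) (rule lp_mult_below)
  then have "(\<lambda>p. p * b) ` (?L \<inter> ?R) = (\<lambda>p. p * b) ` ?L \<inter> (\<lambda>p. p * b) ` ?R"
    by (rule inj_on_image_Int) auto
  then have imLR: "{a. left_star_sharp_le a b} = (\<lambda>p. p * b) ` (?L \<inter> ?R)"
    using imL imR by (auto simp: left_star_sharp_le_iff)
  interpret s: projection_segment left_star_le b ?S
    by unfold_locales (use S in \<open>auto simp: left_star_le_iff\<close>)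
  interpret l: projection_segment left_star_left_sharp_le b ?L
    by unfold_locales (use L imL left_star_left_sharp_le_on_segment in auto)
  interpret r: projection_segment left_star_right_sharp_le b ?R
    by unfold_locales (use R imR left_star_right_sharp_le_on_segment in auto)
  interpret lr: projection_segment left_star_sharp_le b "?L \<inter> ?R"
    by unfold_locales (use LR imLR left_star_sharp_le_on_segment in auto)
  show ?thesis
    \<comment> \<open>Each sublattice claim is now an instance of \<open>sublattice_image\<close>
      for the larger segment, with \<open>T\<close> the set of projections of the smaller
      one.\<close>
    unfolding l.carrier_eq r.carrier_eq lr.carrier_eq
    by (intro conjI l.lattice_axioms r.lattice_axioms lr.lattice_axioms
        s.sublattice_image l.sublattice_image r.sublattice_image L R LR) auto
qed

end
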